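(* Let $E$ be a finite-dimensional real vector space, $A\subset E$, and $L:[0,T]\times A\to E$. Let $B\subset A$ be convex and let $\Delta t_{\max}>0$ be such that $$v+\Delta t\,L(t,v)\in B,\qquad\forall v\in B,\ \forall t\in[0,T],\ \forall\Delta t\in[0,\Delta t_{\max}].$$ Consider an $s$-stage explicit Runge–Kutta method that is SSP, with $(\alpha\text{-}\beta)$ representation given by coefficients $\alpha_{ik},\beta_{ik}$, $0\le k\le i-1$, $1\le i\le s$, and let $c_{\mathrm{os}}:=\inf\{\alpha_{ik}\beta_{ik}^{-1} : \alpha_{ik}\ne0,\ 1\le k+1\le i\le s\}$. Let $u^n\in B$ and assume that $\Delta t\le c_{\mathrm{os}}\Delta t_{\max}$. Then $u^{n+1}\in B$.
   Context: An $s$-stage explicit Runge–Kutta method is given by a Butcher tableau: a strictly lower triangular matrix $(a_{ij})_{1\le i,j\le s}$ and a vector $(b_j)_{1\le j\le s}$; set $c_1:=0$, $c_i:=\sum_{j=1}^{i-1}a_{ij}$ for $2\le i\le s$, and $\gamma_k:=c_{k+1}$ for $0\le k\le s-1$. The method is called SSP if it admits an $(\alpha\text{-}\beta)$ representation: there are real coefficients $\alpha_{ik}\ge0$, $\beta_{ik}\ge0$, $0\le k\le i-1$, $1\le i\le s$, with $\sum_{k=0}^{i-1}\alpha_{ik}=1$ for every $i$ and $\beta_{ik}=0$ whenever $\alpha_{ik}=0$, such that the update $u^{n+1}$ produced from $u^n$ with time step $\Delta t\ge 0$ is obtained by setting $w^{(0)}=u^n$, $$w^{(i)}=\sum_{k=0}^{i-1}\Big(\alpha_{ik}w^{(k)}+\beta_{ik}\,\Delta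 t\,L(t^n+\gamma_k\Delta t,w^{(k)})\Big),\qquad i=1,\dots,s,$$ and $u^{n+1}=w^{(s)}$. Here all times $t^n+\gamma_k\Delta t$ belong to $[0,T]$. In the definition of $c_{\mathrm{os}}$, $\alpha_{ik}\beta_{ik}^{-1}=+\infty$ if $\alpha_{ik}\neq0$ and $\beta_{ik}=0$. *)

theory Defs
  imports "HOL-Analysis.Analysis"
begin

text \<open>
  Butcher tableaux and Shu--Osher type coefficients are functions on \<^typ>\<open>nat\<close>, with the indexing of
  the literature: \<open>a i j\<close> and \<open>b j\<close> are used for indices in \<open>{1..s}\<close>, while \<open>\<alpha> i k\<close> and
  \<open>\<beta> i k\<close> are used for \<open>k < i\<close> and \<open>i \<in> {1..s}\<close>. Values outside these ranges are irrelevant.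
\<close>

definition explicit_tableau :: "nat \<Rightarrow> (nat \<Rightarrow> nat \<Rightarrow> real) \<Rightarrow> bool" where
  "explicit_tableau s a \<longleftrightarrow> 1 \<le> s \<and> (\<forall>i\<in>{1..s}. \<forall>j\<in>{1..s}. i \<le> j \<longrightarrow> a i j = 0)"

definition rk_c :: "(nat \<Rightarrow> nat \<Rightarrow> real) \<Rightarrow> nat \<Rightarrow> real" where
  "rk_c a i = (\<Sum>j=1..<i. a i j)"

definition rk_gamma :: "(nat \<Rightarrow> nat \<Rightarrow> real) \<Rightarrow> nat \<Rightarrow> real" where
  "rk_gamma a k = rk_c a (k + 1)"

text \<open>The right-hand side \<open>L\<close> is a total function; values outside its intended domain are arbitrary.\<close>

fun rk_stage ::
  "(nat \<Rightarrow> nat \<Rightarrow> real) \<Rightarrow> (real \<Rightarrow> 'a \<Rightarrow> 'a) \<Rightarrow> real \<Rightarrow> real \<Rightarrow> 'a \<Rightarrow> nat \<Rightarrow> 'a::real_vector" where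
  "rk_stage a L t dt u i =
     u + dt *\<^sub>R (\<Sum>j=1..<i. a i j *\<^sub>R L (t + rk_c a j * dt) (rk_stage a L t dt u j))"

declare rk_stage.simps [simp del]

definition rk_update ::
  "nat \<Rightarrow> (nat \<Rightarrow> nat \<Rightarrow> real) \<Rightarrow> (nat \<Rightarrow> real) \<Rightarrow> (real \<Rightarrow> 'a \<Rightarrow> 'a) \<Rightarrow> real \<Rightarrow> real \<Rightarrow> 'a
     \<Rightarrow> 'a::real_vector" where
  "rk_update s a b L t dt u =
     u + dt *\<^sub>R (\<Sum>j=1..s. b j *\<^sub>R L (t + rk_c a j * dt) (rk_stage a L t dt u j))"

fun alpha_beta_stage ::
  "(nat \<Rightarrow> real) \<Rightarrow> (nat \<Rightarrow> nat \<Rightarrow> real) \<Rightarrow> (nat \<Rightarrow> nat \<Rightarrow> real) \<Rightarrow> (real \<Rightarrow> 'a \<Rightarrow> 'a) \<Rightarrow> real \<Rightarrow> real \<Rightarrow> 'a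
     \<Rightarrow> nat \<Rightarrow> 'a::real_vector" where
  "alpha_beta_stage \<gamma> \<alpha> \<beta> L t dt u i =
     (if i = 0 then u
      else (\<Sum>k<i. \<alpha> i k *\<^sub>R alpha_beta_stage \<gamma> \<alpha> \<beta> L t dt u k
                 + (\<beta> i k * dt) *\<^sub>R L (t + \<gamma> k * dt) (alpha_beta_stage \<gamma> \<alpha> \<beta> L t dt u k)))"

declare alpha_beta_stage.simps [simp del]

text \<open>
  Being a representation of the method is a property of the coefficients, not of one particular
  problem: the two updates must agree for every right-hand side, initial time, nonnegative step and
  initial value in the phase space \<open>'a\<close>.
\<close>

definition alpha_beta_representation ::
  "'a::real_vector itself \<Rightarrow> nat \<Rightarrow> (nat \<Rightarrow> nat \<Rightarrow> real) \<Rightarrow> (nat \<Rightarrow> real)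
     \<Rightarrow> (nat \<Rightarrow> nat \<Rightarrow> real) \<Rightarrow> (nat \<Rightarrow> nat \<Rightarrow> real) \<Rightarrow> bool" where
  "alpha_beta_representation _ s a b \<alpha> \<beta> \<longleftrightarrow>
     (\<forall>i\<in>{1..s}. \<forall>k<i. 0 \<le> \<alpha> i k \<and> 0 \<le> \<beta> i k \<and> (\<alpha> i k = 0 \<longrightarrow> \<beta> i k = 0)) \<and>
     (\<forall>i\<in>{1..s}. (\<Sum>k<i. \<alpha> i k) = 1) \<and>
     (\<forall>(L :: real \<Rightarrow> 'a \<Rightarrow> 'a) t dt u. 0 \<le> dt \<longrightarrow>
        rk_update s a b L t dt u = alpha_beta_stage (rk_gamma a) \<alpha> \<beta> L t dt u s)"

definition c_os :: "nat \<Rightarrow> (nat \<Rightarrow> nat \<Rightarrow> real) \<Rightarrow> (nat \<Rightarrow> nat \<Rightarrow> real) \<Rightarrow> ereal" where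
  "c_os s \<alpha> \<beta> =
     Inf {if \<beta> i k = 0 then \<infinity> else ereal (\<alpha> i k / \<beta> i k) | i k.
            1 \<le> k + 1 \<and> k + 1 \<le> i \<and> i \<le> s \<and> \<alpha> i k \<noteq> 0}"

end

theory Submission
  imports Defs
begin

text \<open>
  A stage of the Shu--Osher recursion is a convex combination, with weights \<open>\<alpha>\<close>, of forward Euler
  steps: a summand with \<open>\<alpha> > 0\<close> equals
  \<open>\<alpha> *\<^sub>R (w + (\<beta> * dt / \<alpha>) *\<^sub>R L t w)\<close>, and one with \<open>\<alpha> = 0\<close> vanishes since
  then \<open>\<beta> = 0\<close>. The condition
  \<open>dt \<le> c_os * dt_max\<close> says that no rescaled step \<open>\<beta> * dt / \<alpha>\<close> exceeds \<open>dt_max\<close>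
  (\<open>c_os_step_bound\<close>), so each Euler step keeps \<open>B\<close> invariant and convexity keeps the
  combination in \<open>B\<close>. Strong induction on the stage then gives \<open>alpha_beta_stage_in_convex\<close>,
  whose last instance is the Runge--Kutta update.
\<close>

text \<open>
  The conclusion is free of division, so that it also covers vanishing coefficients, where the
  quotient in \<open>c_os\<close> is \<open>\<infinity>\<close> or absent.
\<close>

lemma c_os_step_bound:
  assumes "k < i" "i \<le> s"
    and "0 \<le> \<alpha> i k" "0 \<le> \<beta> i k" "\<alpha> i k = 0 \<longrightarrow> \<beta> i k = 0"
    and "0 \<le> h"
    and cfl: "ereal dt \<le> c_os s \<alpha> \<beta> * ereal h"
  shows "\<beta> i k * dt \<le> \<alpha> i k * h"
proof (cases "\<beta> i k = 0")
  case True
  then show ?thesis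
    using assms by simp
next
  case False
  then have "0 < \<beta> i k" "\<alpha> i k \<noteq> 0"
    using assms by auto
  then have "c_os s \<alpha> \<beta> \<le> ereal (\<alpha> i k / \<beta> i k)"
    unfolding c_os_def using \<open>k < i\<close> \<open>i \<le> s\<close> by (intro Inf_lower CollectI exI[of _ i] exI[of _ k]) auto
  then have "c_os s \<alpha> \<beta> * ereal h \<le> ereal (\<alpha> i k / \<beta> i k) * ereal h"
    using \<open>0 \<le> h\<close> by (intro ereal_mult_right_mono) auto
  with cfl have "ereal dt \<le> ereal (\<alpha> i k / \<beta> i k * h)"
    by (metis order_trans times_ereal.simps(1))
  then show ?thesis
    using \<open>0 < \<beta> i k\<close> by (simp add: field_simps)
qed

text \<open>
  Forward Euler steps of length at most \<open>h\<close> preserve \<open>B\<close>, and each stage is a convex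
  combination of such steps taken from earlier stages.
\<close>

lemma alpha_beta_stage_in_convex:
  fixes B :: "'a::real_vector set"
  assumes "convex B"
    and "0 \<le> h"
    and euler: "\<And>v t \<tau>. \<lbrakk>v \<in> B; t \<in> I; 0 \<le> \<tau>; \<tau> \<le> h\<rbrakk> \<Longrightarrow> v + \<tau> *\<^sub>R L t v \<in> B"
    and coeffs: "\<And>i k. \<lbrakk>k < i; i \<le> s\<rbrakk> \<Longrightarrow>
           0 \<le> \<alpha> i k \<and> 0 \<le> \<beta> i k \<and> (\<alpha> i k = 0 \<longrightarrow> \<beta> i k = 0)"
    and sum1: "\<And>i. \<lbrakk>0 < i; i \<le> s\<rbrakk> \<Longrightarrow> (\<Sum>k<i. \<alpha> i k) = 1"
    and "u \<in> B"
    and "0 \<le> dt"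
    and times: "\<And>k. k < s \<Longrightarrow> t + \<gamma> k * dt \<in> I"
    and cfl: "ereal dt \<le> c_os s \<alpha> \<beta> * ereal h"
    and "i \<le> s"
  shows "alpha_beta_stage \<gamma> \<alpha> \<beta> L t dt u i \<in> B"
  using \<open>i \<le> s\<close>
proof (induction i rule: less_induct)
  case (less i)
  let ?w = "alpha_beta_stage \<gamma> \<alpha> \<beta> L t dt u"
  show ?case
  proof (cases "i = 0")
    case True
    then show ?thesis
      using \<open>u \<in> B\<close> by (simp add: alpha_beta_stage.simps)
  next
    case False
    \<comment> \<open>If \<open>\<alpha> i k = 0\<close>, then the step length is \<open>0\<close> because \<open>x / 0 = 0\<close>, so \<open>y k\<close> is just \<open>?w k\<close>.\<close>
    define y where "y k = ?w k + (\<beta> i k * dt / \<alpha> i k) *\<^sub>R L (t + \<gamma> k * dt) (?w k)" for k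
    have "y k \<in> B" if "k < i" for k
    proof -
      have c: "0 \<le> \<alpha> i k" "0 \<le> \<beta> i k" "\<alpha> i k = 0 \<longrightarrow> \<beta> i k = 0"
        using coeffs[OF that \<open>i \<le> s\<close>] by auto
      have "\<beta> i k * dt \<le> \<alpha> i k * h"
        using c_os_step_bound[where \<alpha>=\<alpha> and \<beta>=\<beta>, OF that \<open>i \<le> s\<close> c \<open>0 \<le> h\<close> cfl] .
      then have "\<beta> i k * dt / \<alpha> i k \<le> h"
        using c \<open>0 \<le> h\<close> by (cases "\<alpha> i k = 0") (auto simp: field_simps)
      moreover have "0 \<le> \<beta> i k * dt / \<alpha> i k"
        using c \<open>0 \<le> dt\<close> by simp
      moreover have "?w k \<in> B" "t + \<gamma> k * dt \<in> I"
        using less that times by auto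
      ultimately show ?thesis
        unfolding y_def by (intro euler)
    qed
    then have "(\<Sum>k<i. \<alpha> i k *\<^sub>R y k) \<in> B"
      using False less.prems coeffs sum1 \<open>convex B\<close> by (intro convex_sum) auto
    moreover have "?w i = (\<Sum>k<i. \<alpha> i k *\<^sub>R y k)"
    proof -
      have "\<alpha> i k *\<^sub>R ?w k + (\<beta> i k * dt) *\<^sub>R L (t + \<gamma> k * dt) (?w k) = \<alpha> i k *\<^sub>R y k"
        if "k < i" for k
        using coeffs[OF that \<open>i \<le> s\<close>] by (cases "\<alpha> i k = 0") (auto simp: y_def scaleR_add_right)
      then show ?thesis
        using False by (subst alpha_beta_stage.simps) simp
    qed
    ultimately show ?thesis
      by simp
  qed
qed

theorem theorem5p4:
  fixes A B :: "'a::real_vector set"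
    and L :: "real \<Rightarrow> 'a \<Rightarrow> 'a"
    and T dt_max tn dt :: real
    and s :: nat
    and a \<alpha> \<beta> :: "nat \<Rightarrow> nat \<Rightarrow> real"
    and b :: "nat \<Rightarrow> real"
    and un :: 'a
  assumes finite_dim: "\<exists>S :: 'a set. finite S \<and> span S = UNIV"
    and "B \<subseteq> A"
    and "convex B"
    and "0 < dt_max"
    and euler: "\<forall>v\<in>B. \<forall>t\<in>{0..T}. \<forall>\<tau>\<in>{0..dt_max}. v + \<tau> *\<^sub>R L t v \<in> B"
    and tableau: "explicit_tableau s a"
    and ssp: "alpha_beta_representation TYPE('a) s a b \<alpha> \<beta>"
    and "un \<in> B"
    and "0 \<le> dt"
    and times: "\<forall>k<s. tn + rk_gamma a k * dt \<in> {0..T}"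
    and cfl: "ereal dt \<le> c_os s \<alpha> \<beta> * ereal dt_max"
  shows "rk_update s a b L tn dt un \<in> B"
proof -
  have "rk_update s a b L tn dt un = alpha_beta_stage (rk_gamma a) \<alpha> \<beta> L tn dt un s"
    using ssp \<open>0 \<le> dt\<close> unfolding alpha_beta_representation_def by blast
  also have "\<dots> \<in> B"
  proof (rule alpha_beta_stage_in_convex[where h = dt_max and I = "{0..T}" and s = s])
    show "0 \<le> \<alpha> i k \<and> 0 \<le> \<beta> i k \<and> (\<alpha> i k = 0 \<longrightarrow> \<beta> i k = 0)" if "k < i" "i \<le> s" for i k
      using ssp that unfolding alpha_beta_representation_def by simp
    show "(\<Sum>k<i. \<alpha> i k) = 1" if "0 < i" "i \<le> s" for i
      using ssp that unfolding alpha_beta_representation_def by simp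
  qed (use assms in auto)
  finally show ?thesis .
qed

end
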